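(* Let $n \in \mathbb{N}$ with $n \geq 2$, and let $K_n$ be the complete graph on $n$ vertices. Then $K_n$ is $\xi$-critical for every $\xi \in \{\alpha,\beta,\omega,\chi\}$.
   Context: Graphs are finite, undirected, simple, without loops. $\alpha(G)$ is the size of a maximum independent set, $\beta(G)$ the size of a minimum vertex cover, $\omega(G)$ the size of a maximum clique, $\chi(G)$ the chromatic number. For a parameter $\xi$, an edge $e\in E(G)$ is $\xi$-critical if $\xi(G-e)\neq\xi(G)$, where $G-e$ is $G$ with $e$ deleted. A graph is $\xi$-critical if all its edges are $\xi$-critical. *)

theory Defs
  imports "HOL-Library.Ramsey"
begin

text \<open>
  Edges are two-element sets of vertices, so that \<open>clique\<close> and \<open>indep\<close>
  from \<^theory>\<open>HOL-Library.Ramsey\<close> apply. The record alone does not enforce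
  well-formedness; \<open>simple_graph\<close> below does.
\<close>

record 'a graph =
  verts :: "'a set"
  edges :: "'a set set"

definition simple_graph :: "'a graph \<Rightarrow> bool" where
  "simple_graph G \<longleftrightarrow> finite (verts G) \<and> edges G \<subseteq> [verts G]\<^bsup>2\<^esup>"

definition delete_edge :: "'a graph \<Rightarrow> 'a set \<Rightarrow> 'a graph" where
  "delete_edge G e = G\<lparr>edges := edges G - {e}\<rparr>"

definition complete_graph :: "'a set \<Rightarrow> 'a graph" where
  "complete_graph V = \<lparr>verts = V, edges = [V]\<^bsup>2\<^esup>\<rparr>"

lemma simple_graph_complete_graph: "finite V \<Longrightarrow> simple_graph (complete_graph V)"
  by (simp add: simple_graph_def complete_graph_def)

lemma simple_graph_delete_edge: "simple_graph G \<Longrightarrow> simple_graph (delete_edge G e)"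
  by (auto simp: simple_graph_def delete_edge_def)

definition vertex_cover :: "'a graph \<Rightarrow> 'a set \<Rightarrow> bool" where
  "vertex_cover G C \<longleftrightarrow> C \<subseteq> verts G \<and> (\<forall>e\<in>edges G. e \<inter> C \<noteq> {})"

definition proper_colouring :: "'a graph \<Rightarrow> nat \<Rightarrow> ('a \<Rightarrow> nat) \<Rightarrow> bool" where
  "proper_colouring G k c \<longleftrightarrow>
     c ` verts G \<subseteq> {..<k} \<and> (\<forall>u v. {u, v} \<in> edges G \<longrightarrow> c u \<noteq> c v)"

text \<open>
  On a \<open>simple_graph\<close> the sets below are finite and nonempty (the empty set is
  a clique and independent, the whole vertex set is a cover), and a proper
  colouring exists, so \<open>Max\<close>, \<open>Min\<close> and \<open>LEAST\<close> are well defined.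
\<close>

definition independence_number :: "'a graph \<Rightarrow> nat" where
  "independence_number G = Max (card ` {S. S \<subseteq> verts G \<and> indep S (edges G)})"

definition vertex_cover_number :: "'a graph \<Rightarrow> nat" where
  "vertex_cover_number G = Min (card ` {C. vertex_cover G C})"

definition clique_number :: "'a graph \<Rightarrow> nat" where
  "clique_number G = Max (card ` {S. S \<subseteq> verts G \<and> clique S (edges G)})"

definition chromatic_number :: "'a graph \<Rightarrow> nat" where
  "chromatic_number G = (LEAST k. \<exists>c. proper_colouring G k c)"

definition critical_edge :: "('a graph \<Rightarrow> nat) \<Rightarrow> 'a graph \<Rightarrow> 'a set \<Rightarrow> bool" where
  "critical_edge \<xi> G e \<longleftrightarrow> e \<in> edges G \<and> \<xi> (delete_edge G e) \<noteq> \<xi> G"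

definition critical_graph :: "('a graph \<Rightarrow> nat) \<Rightarrow> 'a graph \<Rightarrow> bool" where
  "critical_graph \<xi> G \<longleftrightarrow> (\<forall>e\<in>edges G. critical_edge \<xi> G e)"

end

theory Submission
  imports Defs
begin

text \<open>Deleting an edge \<open>{u, v}\<close> from the complete graph on n vertices makes u and
  v the only non-adjacent pair, and this shifts all four parameters. The pair becomes independent,
  so \<alpha> rises from at most 1 to at least 2. The other n - 2 vertices now cover every edge,
  while the complete graph needs n - 1. The whole vertex set stops being a clique, so \<omega> drops
  below n. Finally u and v may share a colour, so n - 1 colours suffice where n were needed. Only
  inequality of the values is wanted, so a one-sided bound on each graph is enough and no parameter
  is computed exactly.\<close>

lemma independence_number_complete_graph_le:
  assumes "finite V"
  shows "independence_number (complete_graph V) \<le> 1"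
proof -
  have "card S \<le> 1" if "S \<subseteq> V" "indep S ([V]\<^bsup>2\<^esup>)" for S
  proof -
    have "x = y" if "x \<in> S" "y \<in> S" for x y
      using that \<open>S \<subseteq> V\<close> \<open>indep S _\<close>
      by (auto simp: indep_def)
    moreover have "finite S"
      using \<open>S \<subseteq> V\<close> assms finite_subset by blast
    ultimately show ?thesis
      by (simp add: card_le_Suc0_iff_eq)
  qed
  \<comment> \<open>A witness that the set under \<open>Max\<close> is nonempty, as
    \<open>Max_le_iff\<close> requires.\<close>
  moreover have "indep {} ([V]\<^bsup>2\<^esup>)"
    by (simp add: indep_def)
  ultimately show ?thesis
    using assms unfolding independence_number_def
    by (subst Max_le_iff) (auto simp: complete_graph_def)
qed

lemma card_le_independence_number:
  assumes "finite (verts G)" "S \<subseteq> verts G" "indep S (edges G)"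
  shows "card S \<le> independence_number G"
  using assms unfolding independence_number_def by (auto intro!: Max_ge)

lemma clique_number_complete_graph_ge:
  assumes "finite V"
  shows "card V \<le> clique_number (complete_graph V)"
proof -
  have "clique V ([V]\<^bsup>2\<^esup>)"
    by (simp add: clique_def)
  then show ?thesis
    using assms unfolding clique_number_def
    by (auto intro!: Max_ge simp: complete_graph_def)
qed

text \<open>In a finite graph only the full vertex set has \<open>card (verts G)\<close> elements,
  so if it is not a clique, every clique is a proper subset and strictly smaller.\<close>

lemma clique_number_less_card:
  assumes "finite (verts G)" "\<not> clique (verts G) (edges G)"
  shows "clique_number G < card (verts G)"
proof -
  have "card S < card (verts G)" if "S \<subseteq> verts G" "clique S (edges G)" for S
    using that assms by (metis psubsetI psubset_card_mono)
  moreover have "clique {} (edges G)"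
    by (simp add: clique_def)
  ultimately show ?thesis
    using assms(1) unfolding clique_number_def by (subst Max_less_iff) auto
qed

text \<open>Two distinct vertices outside a cover would span an uncovered edge, so a cover misses at
  most one vertex.\<close>

lemma vertex_cover_number_complete_graph_ge:
  assumes "finite V"
  shows "card V - 1 \<le> vertex_cover_number (complete_graph V)"
proof -
  have "card V - 1 \<le> card C" if "vertex_cover (complete_graph V) C" for C
  proof -
    have C: "C \<subseteq> V" and cover: "\<And>e. e \<in> [V]\<^bsup>2\<^esup> \<Longrightarrow> e \<inter> C \<noteq> {}"
      using that by (auto simp: vertex_cover_def complete_graph_def)
    have "x = y" if "x \<in> V - C" "y \<in> V - C" for x y
      using that cover[of "{x, y}"] by auto
    then have "card (V - C) \<le> 1"
      using assms by (simp add: card_le_Suc0_iff_eq)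
    then show ?thesis
      using C assms by (simp add: card_Diff_subset finite_subset)
  qed
  moreover have "vertex_cover (complete_graph V) V"
    by (auto simp: vertex_cover_def complete_graph_def elim!: nsets2_E)
  moreover have "finite {C. vertex_cover (complete_graph V) C}"
    using assms by (auto simp: vertex_cover_def complete_graph_def intro: finite_subset[of _ "Pow V"])
  ultimately show ?thesis
    unfolding vertex_cover_number_def by (subst Min_ge_iff) auto
qed

lemma vertex_cover_number_le_card:
  assumes "finite (verts G)" "vertex_cover G C"
  shows "vertex_cover_number G \<le> card C"
proof -
  have "finite {C. vertex_cover G C}"
    using assms(1) by (auto simp: vertex_cover_def intro: finite_subset[of _ "Pow (verts G)"])
  then show ?thesis
    using assms(2) unfolding vertex_cover_number_def by (auto intro!: Min_le)
qed

text \<open>All vertices are pairwise adjacent, so a proper colouring is injective on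
  \<open>V\<close> and needs \<open>card V\<close> colours.\<close>

lemma chromatic_number_complete_graph_ge:
  assumes "finite V"
  shows "card V \<le> chromatic_number (complete_graph V)"
proof -
  have card_le: "card V \<le> k" if "proper_colouring (complete_graph V) k c" for k c
  proof -
    have "c ` V \<subseteq> {..<k}" "inj_on c V"
      using that
      by (auto simp: proper_colouring_def complete_graph_def inj_on_def)
    then show ?thesis
      using card_inj_on_le[of c V "{..<k}"] by simp
  qed
  \<comment> \<open>Some proper colouring must exist before the bound can be applied to the number
    chosen by \<open>LEAST\<close>; an enumeration of \<open>V\<close> is one.\<close>
  obtain f where "bij_betw f V {0..<card V}"
    using ex_bij_betw_finite_nat[OF assms] by blast
  then have "proper_colouring (complete_graph V) (card V) f"
    by (auto simp: proper_colouring_def complete_graph_def bij_betw_def inj_on_def)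
  then have "\<exists>k c. proper_colouring (complete_graph V) k c"
    by blast
  from LeastI_ex[OF this] show ?thesis
    unfolding chromatic_number_def using card_le by blast
qed

text \<open>Enumerate \<open>V - {v}\<close> with distinct colours and let \<open>v\<close> reuse
  the colour of \<open>u\<close>. The only clash is between \<open>u\<close> and \<open>v\<close>,
  whose edge is gone.\<close>

lemma chromatic_number_delete_edge_le:
  assumes "finite V" "u \<in> V" "v \<in> V" "u \<noteq> v"
  shows "chromatic_number (delete_edge (complete_graph V) {u, v}) \<le> card V - 1"
proof -
  obtain f where f: "bij_betw f (V - {v}) {0..<card (V - {v})}"
    using ex_bij_betw_finite_nat[of "V - {v}"] assms(1) by blast
  have inj: "x = y" if "f x = f y" "x \<in> V" "y \<in> V" "x \<noteq> v" "y \<noteq> v" for x y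
    using f that by (auto simp: bij_betw_def inj_on_def)
  have range: "f x < card V - 1" if "x \<in> V" "x \<noteq> v" for x
    using f that assms by (auto simp: bij_betw_def)
  have "proper_colouring (delete_edge (complete_graph V) {u, v}) (card V - 1) (f(v := f u))"
    unfolding proper_colouring_def
  proof (intro conjI allI impI)
    show "(f(v := f u)) ` verts (delete_edge (complete_graph V) {u, v}) \<subseteq> {..<card V - 1}"
      using range assms by (auto simp: delete_edge_def complete_graph_def)
    fix x y
    assume "{x, y} \<in> edges (delete_edge (complete_graph V) {u, v})"
    then have "x \<in> V" "y \<in> V" "x \<noteq> y" "{x, y} \<noteq> {u, v}"
      by (auto simp: delete_edge_def complete_graph_def)
    then show "(f(v := f u)) x \<noteq> (f(v := f u)) y"
      using inj assms by (auto simp: doubleton_eq_iff)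
  qed
  then show ?thesis
    unfolding chromatic_number_def by (intro Least_le) blast
qed

theorem proposition2:
  fixes n :: nat and V :: "'a set"
  assumes "n \<ge> 2" and "finite V" and "card V = n"
  shows "\<forall>\<xi> \<in> {independence_number, vertex_cover_number, clique_number, chromatic_number}.
           critical_graph \<xi> (complete_graph V)"
proof -
  let ?K = "complete_graph V"
  have "independence_number (delete_edge ?K e) \<noteq> independence_number ?K \<and>
        vertex_cover_number (delete_edge ?K e) \<noteq> vertex_cover_number ?K \<and>
        clique_number (delete_edge ?K e) \<noteq> clique_number ?K \<and>
        chromatic_number (delete_edge ?K e) \<noteq> chromatic_number ?K"
    if edge: "e \<in> edges ?K" for e
  proof -
    obtain u v where e: "e = {u, v}" and uv: "u \<in> V" "v \<in> V" "u \<noteq> v"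
      using edge by (auto simp: complete_graph_def elim!: nsets2_E)
    let ?G = "delete_edge ?K e"
    have verts: "verts ?G = V" and edges: "edges ?G = [V]\<^bsup>2\<^esup> - {{u, v}}"
      by (simp_all add: delete_edge_def complete_graph_def e)
    have "indep {u, v} (edges ?G)"
      by (auto simp: indep_def edges doubleton_eq_iff)
    then have alpha: "2 \<le> independence_number ?G"
      using card_le_independence_number[of ?G "{u, v}"] assms uv verts by simp
    \<comment> \<open>An edge avoiding this set would be a two-element subset of
      \<open>{u, v}\<close>, hence the deleted edge itself.\<close>
    have "vertex_cover ?G (V - {u, v})"
      by (auto simp: vertex_cover_def verts edges doubleton_eq_iff elim!: nsets2_E)
    then have beta: "vertex_cover_number ?G \<le> n - 2"
      using vertex_cover_number_le_card[of ?G "V - {u, v}"] assms uv verts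
      by (simp add: card_Diff_subset)
    have "\<not> clique V (edges ?G)"
      using uv by (auto simp: clique_def edges)
    then have omega: "clique_number ?G < n"
      using clique_number_less_card[of ?G] assms verts by simp
    show ?thesis
      \<comment> \<open>Each parameter now has separated bounds. Subtraction on \<open>nat\<close>
        is truncated, so \<open>n - 2 < n - 1\<close> relies on \<open>n \<ge> 2\<close>.\<close>
      using alpha independence_number_complete_graph_le[OF assms(2)]
        beta vertex_cover_number_complete_graph_ge[OF assms(2)]
        omega clique_number_complete_graph_ge[OF assms(2)]
        chromatic_number_delete_edge_le[OF assms(2) uv]
        chromatic_number_complete_graph_ge[OF assms(2)] assms(1,3) e
      by auto
  qed
  then show ?thesis
    by (auto simp: critical_graph_def critical_edge_def)
qed

end
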